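(* Let $\lambda/\mu$ be a skew partition. Then the power series \[ \widetilde g_{\lambda/\mu}(\mathbf x;\mathbf t)=\sum_{T\text{ is an rpp of shape }\lambda/\mu}\mathbf t^{\operatorname{ceq}(T)}\mathbf x^{\operatorname{ircont}(T)}\in\mathbb Z[t_1,t_2,t_3,\ldots][[x_1,x_2,x_3,\ldots]] \] is symmetric in $\mathbf x$, i.e. it is invariant under all permutations of the indeterminates $x_1,x_2,x_3,\ldots$ that fix all but finitely many of them (while $t_1,t_2,t_3,\ldots$ remain unchanged).
   Context: $\mathbb N=\{0,1,2,\ldots\}$, $\mathbb N_+=\{1,2,3,\ldots\}$. A weak composition is a sequence $\alpha=(\alpha_1,\alpha_2,\ldots)$ of nonnegative integers with finite sum; a partition is a weakly decreasing weak composition, identified with its Young diagram $\{(i,j)\in\mathbb N_+^2\mid j\le\lambda_i\}$ (matrix/English notation: $i$ is the row, growing downwards; $j$ is the column). A skew partition $\lambda/\mu$ is a pair of partitions with $\mu\subseteq\lambda$; $\lambda/\mu$ also denotes the set difference of the diagrams. A filling of $\lambda/\mu$ is a map $T:\lambda/\mu\to\mathbb N_+$. A reverse plane partition (rpp) of shape $\lambda/\mu$ is a filling whose entries increase weakly from left to right along rows and weakly from top to bottom down columns. For a filling $T$, $\operatorname{ircont}(T)$ is the weak composition $(r_1,r_2,\ldots)$ where $r_i$ is the number of columns of $T$ that contain an entry equal to $i$. $\operatorname{ceq}(T)$ is the weak composition $(c_1,c_2,\ldots)$ where $c_i$ is the number of $j\in\mathbb N_+$ such that $(i,j)$ and $(i+1,j)$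 are both cells of $\lambda/\mu$ and $T(i,j)=T(i+1,j)$. $x_1,x_2,\ldots$ and $t_1,t_2,\ldots$ are commuting indeterminates; $\mathbf x^\alpha=x_1^{\alpha_1}x_2^{\alpha_2}\cdots$ and $\mathbf t^\alpha=t_1^{\alpha_1}t_2^{\alpha_2}\cdots$ for every weak composition $\alpha$. *)

theory Defs
  imports "HOL-Library.Poly_Mapping" "HOL-Library.FuncSet" "HOL-Combinatorics.Permutations"
begin

text \<open>
  Sequences, rows, columns, entries and indeterminates are all indexed by the positive integers,
  as in the source: the natural number 0 is never used as an index. Thus a weak composition is a
  finitely supported function on the natural numbers that vanishes at 0.
\<close>

type_synonym exponent = "nat \<Rightarrow>\<^sub>0 nat"

definition weak_composition :: "exponent \<Rightarrow> bool" where
  "weak_composition \<alpha> \<longleftrightarrow> Poly_Mapping.lookup \<alpha> 0 = 0"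

definition is_partition :: "exponent \<Rightarrow> bool" where
  "is_partition lam \<longleftrightarrow> weak_composition lam \<and>
     (\<forall>i\<ge>1. Poly_Mapping.lookup lam (i + 1) \<le> Poly_Mapping.lookup lam i)"

definition diagram :: "exponent \<Rightarrow> (nat \<times> nat) set" where
  "diagram lam = {(i, j). 1 \<le> i \<and> 1 \<le> j \<and> j \<le> Poly_Mapping.lookup lam i}"

definition skew_partition :: "exponent \<Rightarrow> exponent \<Rightarrow> bool" where
  "skew_partition lam mu \<longleftrightarrow> is_partition lam \<and> is_partition mu \<and> diagram mu \<subseteq> diagram lam"

definition skew_diagram :: "exponent \<Rightarrow> exponent \<Rightarrow> (nat \<times> nat) set" where
  "skew_diagram lam mu = diagram lam - diagram mu"

text \<open>
  Fillings are extensional functions (undefined outside the diagram), so that every map from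
  the diagram to the positive integers is represented exactly once.
\<close>

definition fillings :: "(nat \<times> nat) set \<Rightarrow> (nat \<times> nat \<Rightarrow> nat) set" where
  "fillings D = D \<rightarrow>\<^sub>E {1..}"

definition rpps :: "(nat \<times> nat) set \<Rightarrow> (nat \<times> nat \<Rightarrow> nat) set" where
  "rpps D = {T \<in> fillings D.
     (\<forall>i j j'. (i, j) \<in> D \<and> (i, j') \<in> D \<and> j < j' \<longrightarrow> T (i, j) \<le> T (i, j')) \<and>
     (\<forall>i i' j. (i, j) \<in> D \<and> (i', j) \<in> D \<and> i < i' \<longrightarrow> T (i, j) \<le> T (i', j))}"

text \<open>
  The functions below have finite support whenever the diagram is finite, which is the case for
  skew partitions; see \<open>lookup_ircont\<close>, \<open>lookup_ceq\<close> and \<open>finite_skew_diagram\<close>.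
\<close>

definition ircont :: "(nat \<times> nat) set \<Rightarrow> (nat \<times> nat \<Rightarrow> nat) \<Rightarrow> exponent" where
  "ircont D T = Abs_poly_mapping (\<lambda>k. card {j. \<exists>i. (i, j) \<in> D \<and> T (i, j) = k})"

definition ceq :: "(nat \<times> nat) set \<Rightarrow> (nat \<times> nat \<Rightarrow> nat) \<Rightarrow> exponent" where
  "ceq D T = Abs_poly_mapping
     (\<lambda>i. card {j. (i, j) \<in> D \<and> (i + 1, j) \<in> D \<and> T (i, j) = T (i + 1, j)})"

text \<open>
  \<open>t_poly\<close> is the ring of integer polynomials in the t-variables (its multiplication in
  \<open>Poly_Mapping\<close> is convolution), and \<open>power_series\<close> consists of the formal power series
  in the x-variables over it, given by their coefficient functions.
\<close>

type_synonym t_poly = "(nat \<Rightarrow>\<^sub>0 nat) \<Rightarrow>\<^sub>0 int"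
type_synonym power_series = "exponent \<Rightarrow> t_poly"

definition t_monom :: "exponent \<Rightarrow> t_poly" where
  "t_monom \<alpha> = Poly_Mapping.single \<alpha> 1"

definition x_term :: "t_poly \<Rightarrow> exponent \<Rightarrow> power_series" where
  "x_term c \<alpha> = (\<lambda>\<beta>. if \<beta> = \<alpha> then c else 0)"

text \<open>
  The sum of a (possibly infinite) family of power series in which every exponent receives
  nonzero contributions from only finitely many members.
\<close>

definition formal_sum :: "'b set \<Rightarrow> ('b \<Rightarrow> power_series) \<Rightarrow> power_series" where
  "formal_sum A F = (\<lambda>\<beta>. \<Sum>T\<in>{T \<in> A. F T \<beta> \<noteq> 0}. F T \<beta>)"

definition g_tilde :: "exponent \<Rightarrow> exponent \<Rightarrow> power_series" where
  "g_tilde lam mu = (let D = skew_diagram lam mu in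
     formal_sum (rpps D) (\<lambda>T. x_term (t_monom (ceq D T)) (ircont D T)))"

text \<open>
  Substituting the indeterminate with index \<open>p i\<close> for the one with index \<open>i\<close> turns the
  monomial with exponent \<open>\<alpha> \<circ> p\<close> into the one with exponent \<open>\<alpha>\<close>. Here
  \<open>Poly_Mapping.map_key p \<alpha>\<close> is \<open>\<alpha> \<circ> p\<close>, as \<open>p\<close> is a bijection.
\<close>

definition permute_x :: "(nat \<Rightarrow> nat) \<Rightarrow> power_series \<Rightarrow> power_series" where
  "permute_x p f = (\<lambda>\<alpha>. f (Poly_Mapping.map_key p \<alpha>))"

definition symmetric_in_x :: "power_series \<Rightarrow> bool" where
  "symmetric_in_x f \<longleftrightarrow>
     (\<forall>p. p permutes {1..} \<and> finite {i. p i \<noteq> i} \<longrightarrow> permute_x p f = f)"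

lemma permute_x_variable:
  assumes "p permutes {1..}"
  shows "permute_x p (x_term c (Poly_Mapping.single i 1)) = x_term c (Poly_Mapping.single (p i) 1)"
proof -
  have inj: "inj p" using permutes_inj[OF assms] .
  have surj: "surj p" using permutes_surj[OF assms] .
  have "Poly_Mapping.map_key p \<alpha> = Poly_Mapping.single i 1 \<longleftrightarrow>
        \<alpha> = Poly_Mapping.single (p i) 1" for \<alpha> :: exponent
  proof
    assume a: "Poly_Mapping.map_key p \<alpha> = Poly_Mapping.single i 1"
    show "\<alpha> = Poly_Mapping.single (p i) 1"
    proof (rule poly_mapping_eqI)
      fix k
      obtain l where l: "k = p l" using surj by blast
      have "Poly_Mapping.lookup \<alpha> k = Poly_Mapping.lookup (Poly_Mapping.map_key p \<alpha>) l"
        using inj by (simp add: map_key.rep_eq l)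
      then show "Poly_Mapping.lookup \<alpha> k = Poly_Mapping.lookup (Poly_Mapping.single (p i) 1) k"
        using a inj by (simp add: l lookup_single when_def inj_eq)
    qed
  qed (simp add: map_key_single[OF inj])
  then show ?thesis by (auto simp: permute_x_def x_term_def)
qed

lemma finite_skew_diagram: "finite (skew_diagram lam mu)"
proof -
  have "diagram lam \<subseteq> (SIGMA i:Poly_Mapping.keys lam. {..Poly_Mapping.lookup lam i})"
    by (auto simp: diagram_def in_keys_iff)
  then have "finite (diagram lam)" by (rule finite_subset) auto
  then show ?thesis by (simp add: skew_diagram_def)
qed

lemma lookup_ircont:
  assumes "finite D"
  shows "Poly_Mapping.lookup (ircont D T) k = card {j. \<exists>i. (i, j) \<in> D \<and> T (i, j) = k}"
proof -
  have "{k. card {j. \<exists>i. (i, j) \<in> D \<and> T (i, j) = k} \<noteq> 0} \<subseteq> T ` D"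
    by (auto simp: card_eq_0_iff)
  then have "finite {k. card {j. \<exists>i. (i, j) \<in> D \<and> T (i, j) = k} \<noteq> 0}"
    by (rule finite_subset) (use assms in simp)
  then show ?thesis by (simp add: ircont_def)
qed

lemma card_nonzero_obtains:
  assumes "card A \<noteq> 0" obtains a where "a \<in> A"
  using assms by (cases "A = {}") auto

lemma lookup_ceq:
  assumes "finite D"
  shows "Poly_Mapping.lookup (ceq D T) i =
    card {j. (i, j) \<in> D \<and> (i + 1, j) \<in> D \<and> T (i, j) = T (i + 1, j)}"
proof -
  have "{i. card {j. (i, j) \<in> D \<and> (i + 1, j) \<in> D \<and> T (i, j) = T (i + 1, j)} \<noteq> 0} \<subseteq> fst ` D"
  proof
    fix i assume "i \<in> {i. card {j. (i, j) \<in> D \<and> (i + 1, j) \<in> D \<and> T (i, j) = T (i + 1, j)} \<noteq> 0}"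
    then have "card {j. (i, j) \<in> D \<and> (i + 1, j) \<in> D \<and> T (i, j) = T (i + 1, j)} \<noteq> 0"
      by (rule CollectD)
    then obtain j where "j \<in> {j. (i, j) \<in> D \<and> (i + 1, j) \<in> D \<and> T (i, j) = T (i + 1, j)}"
      by (rule card_nonzero_obtains)
    then show "i \<in> fst ` D" by force
  qed
  then have "finite {i. card {j. (i, j) \<in> D \<and> (i + 1, j) \<in> D \<and> T (i, j) = T (i + 1, j)} \<noteq> 0}"
    by (rule finite_subset) (use assms in simp)
  then show ?thesis by (simp add: ceq_def)
qed

lemma finite_rpps_ircont:
  assumes "finite D"
  shows "finite {T \<in> rpps D. ircont D T = \<beta>}"
proof -
  have "T \<in> D \<rightarrow>\<^sub>E Poly_Mapping.keys \<beta>" if T: "T \<in> rpps D" "ircont D T = \<beta>" for T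
  proof -
    have "T (i, j) \<in> Poly_Mapping.keys \<beta>" if "(i, j) \<in> D" for i j
    proof -
      have "{j'. \<exists>i'. (i', j') \<in> D \<and> T (i', j') = T (i, j)} \<subseteq> snd ` D" by force
      then have "finite {j'. \<exists>i'. (i', j') \<in> D \<and> T (i', j') = T (i, j)}"
        by (rule finite_subset) (use assms in simp)
      then have "card {j'. \<exists>i'. (i', j') \<in> D \<and> T (i', j') = T (i, j)} \<noteq> 0"
        using that by (auto simp: card_eq_0_iff)
      then show ?thesis
        using lookup_ircont[OF assms, of T "T (i, j)"] T(2) by (simp add: in_keys_iff)
    qed
    then show ?thesis using T(1) by (auto simp: rpps_def fillings_def PiE_iff)
  qed
  then have "{T \<in> rpps D. ircont D T = \<beta>} \<subseteq> (D \<rightarrow>\<^sub>E Poly_Mapping.keys \<beta>)" by blast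
  moreover have "finite (D \<rightarrow>\<^sub>E Poly_Mapping.keys \<beta>)" using assms by (intro finite_PiE) auto
  ultimately show ?thesis by (rule finite_subset)
qed

text \<open>Hence the sum defining \<open>g_tilde\<close> is a well-defined formal sum:\<close>

lemma g_tilde_summable:
  assumes "D = skew_diagram lam mu"
  shows "finite {T \<in> rpps D. x_term (t_monom (ceq D T)) (ircont D T) \<beta> \<noteq> 0}"
  by (rule finite_subset[OF _ finite_rpps_ircont[of D \<beta>]])
     (use assms finite_skew_diagram in \<open>auto simp: x_term_def split: if_splits\<close>)

lemma t_monom_nonzero: "t_monom \<alpha> \<noteq> 0"
proof
  assume "t_monom \<alpha> = 0"
  then have "Poly_Mapping.lookup (t_monom \<alpha>) \<alpha> = 0" by simp
  then show False by (simp add: t_monom_def)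
qed

lemma g_tilde_coeff:
  assumes "D = skew_diagram lam mu"
  shows "g_tilde lam mu \<beta> = (\<Sum>T\<in>{T \<in> rpps D. ircont D T = \<beta>}. t_monom (ceq D T))"
proof -
  have "{T \<in> rpps D. x_term (t_monom (ceq D T)) (ircont D T) \<beta> \<noteq> 0}
      = {T \<in> rpps D. ircont D T = \<beta>}"
    by (auto simp: x_term_def t_monom_nonzero)
  then show ?thesis
    by (auto simp: g_tilde_def assms[symmetric] formal_sum_def x_term_def intro!: sum.cong)
qed

text \<open>The indeterminates with index 0 do not occur in \<open>g_tilde\<close>:\<close>

lemma weak_composition_ircont_ceq:
  assumes "D = skew_diagram lam mu" "T \<in> rpps D"
  shows "weak_composition (ircont D T)" "weak_composition (ceq D T)"
proof -
  have fin: "finite D" using assms(1) finite_skew_diagram by simp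
  have empty: "{j. \<exists>i. (i, j) \<in> D \<and> T (i, j) = 0} = {}"
    using assms(2) by (fastforce simp: rpps_def fillings_def PiE_iff)
  show "weak_composition (ircont D T)"
    unfolding weak_composition_def lookup_ircont[OF fin] empty by simp
  have "(0, j) \<notin> D" for j using assms(1) by (simp add: skew_diagram_def diagram_def)
  then show "weak_composition (ceq D T)"
    by (simp add: weak_composition_def lookup_ceq[OF fin])
qed

end

theory Submission
  imports Defs "HOL-Library.Product_Plus"
begin

text \<open>
  It suffices to exchange two adjacent indeterminates \<open>x\<^sub>k\<close> and \<open>x\<^sub>k\<^sub>+\<^sub>1\<close>. Group the reverse plane
  partitions \<open>T\<close> by the filling \<open>U\<close> obtained from \<open>T\<close> by replacing every \<open>k + 1\<close> with \<open>k\<close>. The cells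
  of \<open>U\<close> with entry \<open>k\<close> form a convex set whose nonempty columns are intervals \<open>a j \<le> i < b j\<close> with
  \<open>a\<close> and \<open>b\<close> weakly decreasing, and \<open>T\<close> is determined by the first row \<open>s j\<close> in column \<open>j\<close> with
  entry \<open>k + 1\<close> (\<open>s j = b j\<close> if there is none). The row condition says exactly that \<open>s\<close> is weakly
  decreasing. Column \<open>j\<close> contributes \<open>x\<^sub>k\<close> if \<open>s j = b j\<close>, \<open>x\<^sub>k\<^sub>+\<^sub>1\<close> if \<open>s j = a j\<close>, and otherwise both,
  together with a factor depending only on \<open>s j\<close> that records the lost vertical equality. The sum of
  these weights over all \<open>s\<close> is symmetric in \<open>x\<^sub>k\<close> and \<open>x\<^sub>k\<^sub>+\<^sub>1\<close>. Instead of an involution, the proof of this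
  adds the columns one at a time, keeping track of the divided difference, with respect to the
  exchange of the two indeterminates, of the sums over the \<open>s\<close> bounded below by \<open>c\<close>.
\<close>

subsection \<open>Weakly decreasing sequences between two bounds\<close>

definition boxed_antitone :: "nat set \<Rightarrow> (nat \<Rightarrow> nat) \<Rightarrow> (nat \<Rightarrow> nat) \<Rightarrow> (nat \<Rightarrow> nat) set" where
  "boxed_antitone J a b = {s \<in> (\<Pi>\<^sub>E j\<in>J. {a j..b j}). antimono_on J s}"

text \<open>Contribution of one column with separator \<open>v\<close>: \<open>p\<close> and
  \<open>q\<close> stand for \<open>x k\<close> and \<open>x (Suc k)\<close>, and \<open>u v\<close>
  pays for the break that the separator creates.\<close>

definition sep_weight :: "'r \<Rightarrow> 'r \<Rightarrow> (nat \<Rightarrow> 'r) \<Rightarrow> nat \<Rightarrow> nat \<Rightarrow> nat \<Rightarrow> 'r::comm_ring_1" where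
  "sep_weight p q u a b v = (if v = b then p else if v = a then q else p * q * u v)"

definition bounded_gf ::
  "'r \<Rightarrow> 'r \<Rightarrow> (nat \<Rightarrow> 'r) \<Rightarrow> nat set \<Rightarrow> (nat \<Rightarrow> nat) \<Rightarrow> (nat \<Rightarrow> nat) \<Rightarrow> nat \<Rightarrow> 'r::comm_ring_1" where
  "bounded_gf p q u J a b c =
     (\<Sum>s\<in>{s \<in> boxed_antitone J a b. \<forall>j\<in>J. c \<le> s j}. \<Prod>j\<in>J. sep_weight p q u (a j) (b j) (s j))"

lemma bounded_gf_empty: "bounded_gf p q u {} a b c = 1"
proof -
  have "{s \<in> boxed_antitone {} a b. \<forall>j\<in>{}. c \<le> s j} = {\<lambda>_. undefined}"
    by (auto simp: boxed_antitone_def monotone_on_def)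
  then show ?thesis by (simp add: bounded_gf_def)
qed

lemma finite_boxed_antitone: "finite J \<Longrightarrow> finite (boxed_antitone J a b)"
  unfolding boxed_antitone_def by (rule finite_subset[OF _ finite_PiE[of J "\<lambda>j. {a j..b j}"]]) auto

text \<open>As \<open>m\<close> is the last index, its value \<open>v\<close> is the smallest. The
  bound \<open>c\<close> therefore constrains only \<open>v\<close>, and \<open>v\<close> in turn
  becomes the bound for the remaining columns.\<close>

lemma bounded_gf_insert:
  assumes fin: "finite J" and max: "\<And>j. j \<in> J \<Longrightarrow> j < m"
  shows "bounded_gf p q u (insert m J) a b c =
    (\<Sum>v\<in>{max (a m) c..b m}. sep_weight p q u (a m) (b m) v * bounded_gf p q u J a b v)"
proof -
  let ?w = "\<lambda>j. sep_weight p q u (a j) (b j)"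
  let ?S = "SIGMA v:{max (a m) c..b m}. {s \<in> boxed_antitone J a b. \<forall>j\<in>J. v \<le> s j}"
  have m: "m \<notin> J" using max by blast
  have "bounded_gf p q u (insert m J) a b c =
      (\<Sum>(v, s)\<in>?S. ?w m v * (\<Prod>j\<in>J. ?w j (s j)))"
    unfolding bounded_gf_def
  proof (rule sum.reindex_bij_witness[where j = "\<lambda>s. (s m, restrict s J)"
        and i = "\<lambda>(v, s). s(m := v)"], goal_cases)
    case (1 s)
    then show ?case
      by (auto simp: boxed_antitone_def PiE_iff extensional_def fun_eq_iff)
  next
    case (2 s)
    then have "s m \<le> s j" if "j \<in> J" for j
      using max[OF that] that by (auto simp: boxed_antitone_def monotone_on_def)
    then show ?case using 2 by (auto simp: boxed_antitone_def PiE_iff monotone_on_def)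
  next
    case (3 vs)
    then show ?case
      using m by (auto simp: boxed_antitone_def PiE_iff extensional_def fun_eq_iff)
  next
    case (4 vs)
    then show ?case
      using m by (auto simp: boxed_antitone_def PiE_iff extensional_def monotone_on_def
          dest: max leD less_imp_le intro: order_trans)
  next
    case (5 s)
    then show ?case using m fin by (auto intro!: prod.cong)
  qed
  also have "\<dots> = (\<Sum>v\<in>{max (a m) c..b m}. \<Sum>s\<in>{s \<in> boxed_antitone J a b. \<forall>j\<in>J. v \<le> s j}.
      ?w m v * (\<Prod>j\<in>J. ?w j (s j)))"
    by (rule sum.Sigma[symmetric]) (use finite_boxed_antitone[OF fin] in auto)
  finally show ?thesis by (simp add: bounded_gf_def sum_distrib_left)
qed

text \<open>The bound \<open>c\<close> enters in two ways: beyond \<open>a\<close> it cuts off the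
  value \<open>v = a\<close>; up to \<open>a\<close> it is vacuous, and the term
  \<open>q * g a\<close> appears as in \<open>sum_sep_weight_all\<close>.\<close>

lemma sum_sep_weight:
  assumes "a < c" "c \<le> b"
  shows "(\<Sum>v\<in>{max a c..b}. sep_weight p q u a b v * g v) =
    p * g b + p * q * (\<Sum>v\<in>{c..<b}. u v * g v)"
proof -
  have "{max a c..b} = insert b {c..<b}" using assms by auto
  then have "(\<Sum>v\<in>{max a c..b}. sep_weight p q u a b v * g v) =
      p * g b + (\<Sum>v\<in>{c..<b}. sep_weight p q u a b v * g v)" by (simp add: sep_weight_def)
  also have "(\<Sum>v\<in>{c..<b}. sep_weight p q u a b v * g v) = (\<Sum>v\<in>{c..<b}. p * q * (u v * g v))"
    by (rule sum.cong) (use assms in \<open>auto simp: sep_weight_def algebra_simps\<close>)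
  finally show ?thesis by (simp add: sum_distrib_left)
qed

lemma sum_sep_weight_all:
  assumes "c \<le> a" "a < b"
  shows "(\<Sum>v\<in>{max a c..b}. sep_weight p q u a b v * g v) =
    q * g a + p * g b + p * q * (\<Sum>v\<in>{Suc a..<b}. u v * g v)"
proof -
  have "{max a c..b} = insert a {max a (Suc a)..b}" using assms by auto
  then have "(\<Sum>v\<in>{max a c..b}. sep_weight p q u a b v * g v) =
      q * g a + (\<Sum>v\<in>{max a (Suc a)..b}. sep_weight p q u a b v * g v)"
    using assms by (simp add: sep_weight_def)
  then show ?thesis using sum_sep_weight[of a "Suc a" b p q u g] assms by simp
qed

text \<open>
  \<open>H\<close> is the divided difference of \<open>bounded_gf\<close>; the other two clauses are what makes the induction
  on \<open>J\<close> go through. For \<open>c\<close> beyond the bounds \<open>b j\<close> nothing is claimed. In the induction step the new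
  divided difference is \<open>?G c + q * H c\<close>, the divided difference of \<open>p * ?G c\<close>.
\<close>

lemma bounded_gf_divided_difference:
  fixes p q :: "'r::comm_ring_1"
  assumes "finite J"
    and "\<And>j. j \<in> J \<Longrightarrow> a j < b j"
    and "antimono_on J a" "antimono_on J b"
  shows "\<exists>H. (\<forall>c. (\<forall>j\<in>J. c \<le> b j) \<longrightarrow>
        bounded_gf p q u J a b c - bounded_gf q p u J a b c = (p - q) * H c \<and>
        bounded_gf p q u J a b c + q * H c + p * q * (\<Sum>s<c. u s * H s) = bounded_gf p q u J a b 0) \<and>
      (\<forall>c. (\<forall>j\<in>J. c \<le> a j) \<longrightarrow> H c = 0)"
  using assms
proof (induction J rule: finite_linorder_max_induct)
  case empty
  show ?case by (rule exI[of _ "\<lambda>_. 0"]) (simp add: bounded_gf_empty)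
next
  case (insert m J)
  let ?A = "a m" and ?B = "b m"
  let ?G = "bounded_gf p q u J a b" and ?G' = "bounded_gf q p u J a b"
  let ?G1 = "bounded_gf p q u (insert m J) a b" and ?G1' = "bounded_gf q p u (insert m J) a b"
  have AB: "?A < ?B" using insert.prems by simp
  \<comment> \<open>The bounds of the last column are the smallest, so every
    \<open>c \<le> ?B\<close> is in the range of the induction hypothesis, and \<open>H\<close>
    vanishes up to \<open>?A\<close>.\<close>
  have aA: "?A \<le> a j" and bB: "?B \<le> b j" if "j \<in> J" for j
    using insert.prems(2,3) insert.hyps(2) that by (auto simp: monotone_on_def dest: less_imp_le)
  have "antimono_on J a" "antimono_on J b"
    using insert.prems(2,3) by (auto simp: monotone_on_def)
  then have "\<exists>H. (\<forall>c. (\<forall>j\<in>J. c \<le> b j) \<longrightarrow> ?G c - ?G' c = (p - q) * H c \<and>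
        ?G c + q * H c + p * q * (\<Sum>s<c. u s * H s) = ?G 0) \<and>
      (\<forall>c. (\<forall>j\<in>J. c \<le> a j) \<longrightarrow> H c = 0)"
    by (intro insert.IH) (simp_all add: insert.prems(1))
  then obtain H where H: "\<And>c. (\<forall>j\<in>J. c \<le> b j) \<Longrightarrow> ?G c - ?G' c = (p - q) * H c"
       "\<And>c. (\<forall>j\<in>J. c \<le> b j) \<Longrightarrow> ?G c + q * H c + p * q * (\<Sum>s<c. u s * H s) = ?G 0"
       "\<And>c. (\<forall>j\<in>J. c \<le> a j) \<Longrightarrow> H c = 0"
    by (elim exE conjE) simp
  have diff: "?G' c = ?G c - (p - q) * H c" if "c \<le> ?B" for c
    using H(1)[of c] bB that by (force simp: algebra_simps)
  have inv: "?G c + q * H c = ?G 0 - p * q * (\<Sum>s<c. u s * H s)" if "c \<le> ?B" for c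
    using H(2)[of c] bB that by (force simp: algebra_simps)
  have H0: "H c = 0" if "c \<le> ?A" for c
    using H(3)[of c] aA that by force
  have GA: "?G ?A = ?G 0" using inv[of ?A] H0 AB by simp
  have sum0: "(\<Sum>s<c. u s * H s) = (\<Sum>s=Suc ?A..<c. u s * H s)" for c
    by (rule sum.mono_neutral_right) (auto simp: H0)
  have G1: "?G1 c = p * ?G ?B + p * q * (\<Sum>v=c..<?B. u v * ?G v)"
    and G1': "?G1' c = q * ?G' ?B + p * q * (\<Sum>v=c..<?B. u v * ?G' v)"
    if "?A < c" "c \<le> ?B" for c
    using sum_sep_weight[OF that, of p q u ?G] sum_sep_weight[OF that, of q p u ?G']
      insert.hyps(1,2) by (simp_all add: bounded_gf_insert mult.commute)
  have G1low: "?G1 c = q * ?G ?A + p * ?G ?B + p * q * (\<Sum>v=Suc ?A..<?B. u v * ?G v)"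
    and G1low': "?G1' c = p * ?G' ?A + q * ?G' ?B + p * q * (\<Sum>v=Suc ?A..<?B. u v * ?G' v)"
    if "c \<le> ?A" for c
    using sum_sep_weight_all[OF that AB, of p q u ?G] sum_sep_weight_all[OF that AB, of q p u ?G']
      insert.hyps(1,2) by (simp_all add: bounded_gf_insert mult.commute)
  have step: "?G1 c - ?G1' c = (p - q) * (?G c + q * H c)" if c: "?A < c" "c \<le> ?B" for c
  proof -
    have sum': "(\<Sum>v=c..<?B. u v * ?G' v) = (\<Sum>v=c..<?B. u v * ?G v) - (p - q) * (\<Sum>v=c..<?B. u v * H v)"
      by (simp add: diff sum_subtractf[symmetric] sum_distrib_left algebra_simps)
    have diff1: "?G1 c - ?G1' c =
        (p - q) * ((?G ?B + q * H ?B) + p * q * (\<Sum>v=c..<?B. u v * H v))"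
      unfolding G1[OF c] G1'[OF c] sum' diff[of ?B, simplified] by (simp add: algebra_simps)
    have split: "(\<Sum>s<?B. u s * H s) = (\<Sum>s<c. u s * H s) + (\<Sum>s=c..<?B. u s * H s)"
      using c(2) by (simp add: lessThan_atLeast0 sum.atLeastLessThan_concat)
    \<comment> \<open>The invariants at \<open>?B\<close> and at \<open>c\<close> differ by exactly
      this sum, which carries the value at \<open>?B\<close> down to \<open>c\<close>.\<close>
    have "(?G ?B + q * H ?B) + p * q * (\<Sum>v=c..<?B. u v * H v) = ?G c + q * H c"
      unfolding inv[OF c(2)] inv[of ?B, simplified] split by (simp add: algebra_simps)
    with diff1 show ?thesis by simp
  qed
  define H1 where "H1 c = (if c \<le> ?A then 0 else ?G c + q * H c)" for c
  \<comment> \<open>Admitting \<open>v = ?A\<close> adds \<open>q * ?G 0\<close> on one side and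
    \<open>p * ?G 0\<close> on the other. This cancels the asymmetry \<open>(p - q) * ?G 0\<close>
    present at \<open>Suc ?A\<close>, whence \<open>H1\<close> is 0 up to \<open>?A\<close>.\<close>
  have low_eq: "?G1 c = q * ?G 0 + ?G1 (Suc ?A)" "?G1' c = p * ?G 0 + ?G1' (Suc ?A)" if "c \<le> ?A" for c
    using that AB G1low G1low' G1[of "Suc ?A"] G1'[of "Suc ?A"] diff[of ?A] H0[of ?A] GA by auto
  have "?G1 c - ?G1' c = (p - q) * H1 c" if "c \<le> ?B" for c
  proof (cases "c \<le> ?A")
    case True
    have "?G (Suc ?A) + q * H (Suc ?A) = ?G 0" using inv[of "Suc ?A"] AB by (simp add: sum0)
    then have "?G1 (Suc ?A) - ?G1' (Suc ?A) = (p - q) * ?G 0" using step[of "Suc ?A"] AB by simp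
    then have "?G1 c - ?G1' c = 0" unfolding low_eq[OF True] by (simp add: algebra_simps)
    then show ?thesis by (simp add: H1_def True)
  qed (use that step in \<open>auto simp: H1_def\<close>)
  moreover have "?G1 c + q * H1 c + p * q * (\<Sum>s<c. u s * H1 s) = ?G1 0" if "c \<le> ?B" for c
  proof (cases "c \<le> ?A")
    case True
    then have "(\<Sum>s<c. u s * H1 s) = 0" by (intro sum.neutral) (auto simp: H1_def)
    then show ?thesis using low_eq[of c] low_eq[of 0] True by (simp add: H1_def)
  next
    case False
    then have c: "?A < c" by simp
    have "(\<Sum>s<c. u s * H1 s) = (\<Sum>s=Suc ?A..<c. u s * H1 s)"
      by (rule sum.mono_neutral_right) (auto simp: H1_def)
    also have "\<dots> = (\<Sum>s=Suc ?A..<c. u s * ?G s) + q * (\<Sum>s=Suc ?A..<c. u s * H s)"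
      by (simp add: H1_def sum.distrib sum_distrib_left algebra_simps)
    finally have e1: "(\<Sum>s<c. u s * H1 s) = (\<Sum>s=Suc ?A..<c. u s * ?G s) + q * (\<Sum>s<c. u s * H s)"
      by (simp add: sum0)
    have "(\<Sum>v=Suc ?A..<?B. u v * ?G v) = (\<Sum>v=Suc ?A..<c. u v * ?G v) + (\<Sum>v=c..<?B. u v * ?G v)"
      using c that by (simp add: sum.atLeastLessThan_concat)
    then have e2: "?G1 (Suc ?A) = ?G1 c + p * q * (\<Sum>s=Suc ?A..<c. u s * ?G s)"
      using G1[OF c that] G1[of "Suc ?A"] AB by (simp add: algebra_simps)
    have e3: "H1 c = ?G c + q * H c" using c by (simp add: H1_def)
    \<comment> \<open>The sums of \<open>u s * H s\<close> coming from \<open>e1\<close> and from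
      \<open>inv\<close> cancel, and \<open>low_eq\<close> with \<open>e2\<close> accounts for the
      rest.\<close>
    show ?thesis unfolding low_eq(1)[of 0, simplified] e1 e2 e3 inv[OF that] by (simp add: algebra_simps)
  qed
  ultimately show ?case by (intro exI[of _ H1]) (simp add: H1_def)
qed

text \<open>At \<open>c = 0\<close> the lower bound is vacuous and the divided difference is
  0.\<close>

lemma sum_sep_weight_symmetric:
  fixes p q :: "'r::comm_ring_1"
  assumes "finite J" "\<And>j. j \<in> J \<Longrightarrow> a j < b j" "antimono_on J a" "antimono_on J b"
  shows "(\<Sum>s\<in>boxed_antitone J a b. \<Prod>j\<in>J. sep_weight p q u (a j) (b j) (s j)) =
         (\<Sum>s\<in>boxed_antitone J a b. \<Prod>j\<in>J. sep_weight q p u (a j) (b j) (s j))"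
proof -
  have "bounded_gf p q u J a b 0 - bounded_gf q p u J a b 0 = 0"
    using bounded_gf_divided_difference[OF assms, of p q u] by force
  then show ?thesis by (simp add: bounded_gf_def)
qed

subsection \<open>Reverse plane partitions that differ only in the entries \<open>k\<close> and \<open>k + 1\<close>\<close>

text \<open>Order convexity for the componentwise order. Together with finiteness, this is what the
  exchange argument uses of a skew shape.\<close>

definition convex_cells :: "(nat \<times> nat) set \<Rightarrow> bool" where
  "convex_cells D \<longleftrightarrow> (\<forall>i i' i'' j j' j''. (i, j) \<in> D \<and> (i'', j'') \<in> D \<and>
     i \<le> i' \<and> i' \<le> i'' \<and> j \<le> j' \<and> j' \<le> j'' \<longrightarrow> (i', j') \<in> D)"

lemma convex_cellsD:
  "\<lbrakk>convex_cells D; (i, j) \<in> D; (i'', j'') \<in> D; i \<le> i'; i' \<le> i''; j \<le> j'; j' \<le> j''\<rbrakk> \<Longrightarrow> (i', j') \<in> D"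
  unfolding convex_cells_def by blast

lemma partition_antimono:
  assumes "is_partition lam" "1 \<le> i" "i \<le> i'"
  shows "Poly_Mapping.lookup lam i' \<le> Poly_Mapping.lookup lam i"
  using assms(3,2)
proof (induction rule: dec_induct)
  case (step n)
  then have "Poly_Mapping.lookup lam (Suc n) \<le> Poly_Mapping.lookup lam n"
    using assms(1) by (simp add: is_partition_def)
  with step show ?case by simp
qed simp

lemma convex_skew_diagram:
  assumes "is_partition lam" "is_partition mu"
  shows "convex_cells (skew_diagram lam mu)"
  unfolding convex_cells_def
proof (intro allI impI, elim conjE)
  fix i i' i'' j j' j''
  assume c: "(i, j) \<in> skew_diagram lam mu" "(i'', j'') \<in> skew_diagram lam mu"
    and le: "i \<le> i'" "i' \<le> i''" "j \<le> j'" "j' \<le> j''"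
  have "1 \<le> i" using c(1) by (simp add: skew_diagram_def diagram_def)
  then have "Poly_Mapping.lookup lam i'' \<le> Poly_Mapping.lookup lam i'"
    "Poly_Mapping.lookup mu i' \<le> Poly_Mapping.lookup mu i"
    using partition_antimono assms le by simp_all
  then show "(i', j') \<in> skew_diagram lam mu"
    using c le by (auto simp: skew_diagram_def diagram_def)
qed

text \<open>Convexity puts the corner \<open>(i, j')\<close> into \<open>D\<close>, so one
  comparison along a row and one down a column suffice.\<close>

lemma rpp_mono:
  assumes "T \<in> rpps D" "convex_cells D" "(i, j) \<in> D" "(i', j') \<in> D" "i \<le> i'" "j \<le> j'"
  shows "T (i, j) \<le> T (i', j')"
proof -
  have "(i, j') \<in> D" using convex_cellsD[OF assms(2-4)] assms(5,6) by blast
  then have "T (i, j) \<le> T (i, j')" "T (i, j') \<le> T (i', j')"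
    using assms unfolding rpps_def by (cases "j = j'"; cases "i = i'"; fastforce)+
  then show ?thesis by simp
qed

section \<open>Weights of fillings, column by column\<close>

definition column_values :: "(nat \<times> nat) set \<Rightarrow> (nat \<times> nat \<Rightarrow> nat) \<Rightarrow> nat \<Rightarrow> nat set" where
  "column_values D T j = {r. \<exists>i. (i, j) \<in> D \<and> T (i, j) = r}"

definition column_breaks :: "(nat \<times> nat) set \<Rightarrow> (nat \<times> nat \<Rightarrow> nat) \<Rightarrow> nat \<Rightarrow> nat set" where
  "column_breaks D T j = {i. (i, j) \<in> D \<and> (Suc i, j) \<in> D \<and> T (i, j) \<noteq> T (Suc i, j)}"

text \<open>A column contributes one \<open>x r\<close> per value \<open>r\<close> in it, so the
  \<open>x\<close> part is the monomial with exponent \<open>ircont D T\<close>. A break is recorded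
  in its upper row.\<close>

definition rpp_weight ::
  "(nat \<Rightarrow> 'r) \<Rightarrow> (nat \<Rightarrow> 'r) \<Rightarrow> (nat \<times> nat) set \<Rightarrow> (nat \<times> nat \<Rightarrow> nat) \<Rightarrow> 'r::comm_ring_1" where
  "rpp_weight x u D T =
     (\<Prod>j\<in>snd ` D. (\<Prod>r\<in>column_values D T j. x r) * (\<Prod>i\<in>column_breaks D T j. u i))"

lemma finite_column_values: "finite D \<Longrightarrow> finite (column_values D T j)"
  by (rule finite_subset[of _ "T ` D"]) (auto simp: column_values_def)

lemma finite_column_breaks: "finite D \<Longrightarrow> finite (column_breaks D T j)"
  by (rule finite_subset[of _ "fst ` D"]) (force simp: column_breaks_def)+

definition merge :: "nat \<Rightarrow> nat \<Rightarrow> nat" where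
  "merge k r = (if r = Suc k then k else r)"

section \<open>Reverse plane partitions with a common merged filling\<close>

locale merged_rpp =
  fixes D :: "(nat \<times> nat) set" and k :: nat and U :: "nat \<times> nat \<Rightarrow> nat"
  assumes finite_D: "finite D" and convex_D: "convex_cells D"
    and U_rpp: "U \<in> rpps D" and U_merged: "c \<in> D \<Longrightarrow> U c \<noteq> Suc k"
begin

definition Z :: "(nat \<times> nat) set" where "Z = {c \<in> D. U c = k}"
definition J :: "nat set" where "J = snd ` Z"
text \<open>The rows of \<open>Z\<close> in a column \<open>j\<close> of \<open>J\<close> form a
  half-open interval, so that \<open>s j = b j\<close> can encode the absence of
  \<open>Suc k\<close>.\<close>

definition a :: "nat \<Rightarrow> nat" where "a j = Min {i. (i, j) \<in> Z}"
definition b :: "nat \<Rightarrow> nat" where "b j = Suc (Max {i. (i, j) \<in> Z})"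

definition split_filling :: "(nat \<Rightarrow> nat) \<Rightarrow> nat \<times> nat \<Rightarrow> nat" where
  "split_filling s =
     (\<lambda>(i, j)\<in>D. if U (i, j) = k then (if i < s j then k else Suc k) else U (i, j))"

definition merge_class :: "(nat \<times> nat \<Rightarrow> nat) set" where
  "merge_class = {T \<in> rpps D. \<forall>c\<in>D. merge k (T c) = U c}"

lemma finite_Z: "finite Z" and finite_J: "finite J"
  using finite_D by (simp_all add: Z_def J_def)

text \<open>A cell between two cells with entry \<open>k\<close> lies in \<open>D\<close> by
  convexity and has entry \<open>k\<close> by \<open>rpp_mono\<close>.\<close>

lemma convex_Z: "convex_cells Z"
  unfolding convex_cells_def
proof (intro allI impI, elim conjE)
  fix i i' i'' j j' j''
  assume c: "(i, j) \<in> Z" "(i'', j'') \<in> Z" and le: "i \<le> i'" "i' \<le> i''" "j \<le> j'" "j' \<le> j''"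
  then have d: "(i, j) \<in> D" "(i'', j'') \<in> D" "U (i, j) = k" "U (i'', j'') = k" by (auto simp: Z_def)
  have D: "(i', j') \<in> D" using convex_cellsD[OF convex_D d(1,2)] le by blast
  have "U (i, j) \<le> U (i', j')" "U (i', j') \<le> U (i'', j'')"
    using rpp_mono[OF U_rpp convex_D] d D le by blast+
  then show "(i', j') \<in> Z" using D d by (simp add: Z_def)
qed

lemma finite_Z_column: "finite {i. (i, j) \<in> Z}"
  by (rule finite_subset[of _ "fst ` Z"]) (force simp: finite_Z)+

lemma Z_column_ends:
  assumes "j \<in> J" shows "(a j, j) \<in> Z" "(b j - 1, j) \<in> Z"
proof -
  have "{i. (i, j) \<in> Z} \<noteq> {}" using assms by (auto simp: J_def)
  then show "(a j, j) \<in> Z" "(b j - 1, j) \<in> Z"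
    using Min_in[OF finite_Z_column, of j] Max_in[OF finite_Z_column, of j] by (auto simp: a_def b_def)
qed

lemma in_Z_iff: "(i, j) \<in> Z \<longleftrightarrow> j \<in> J \<and> a j \<le> i \<and> i < b j"
proof
  assume "(i, j) \<in> Z"
  then show "j \<in> J \<and> a j \<le> i \<and> i < b j"
    using finite_Z_column[of j] by (auto simp: a_def b_def J_def less_Suc_eq_le intro: rev_image_eqI)
next
  assume r: "j \<in> J \<and> a j \<le> i \<and> i < b j"
  then have "i \<le> b j - 1" by linarith
  with r convex_cellsD[OF convex_Z Z_column_ends(1,2)] show "(i, j) \<in> Z" by blast
qed

lemma a_less_b: "j \<in> J \<Longrightarrow> a j < b j"
  using Z_column_ends(1) in_Z_iff by blast

text \<open>Otherwise convexity between the two column tops puts \<open>(a j, j')\<close> into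
  \<open>Z\<close>, above the top of column \<open>j'\<close>.\<close>

lemma antimono_a: "antimono_on J a"
proof (intro monotone_onI, rule ccontr)
  fix j j' assume j: "j \<in> J" "j' \<in> J" "j \<le> j'" "\<not> a j' \<le> a j"
  have "(a j, j') \<in> Z"
    by (rule convex_cellsD[OF convex_Z Z_column_ends(1)[OF j(1)] Z_column_ends(1)[OF j(2)]])
       (use j in auto)
  then show False using j(4) in_Z_iff by blast
qed

lemma antimono_b: "antimono_on J b"
proof (intro monotone_onI, rule ccontr)
  fix j j' assume j: "j \<in> J" "j' \<in> J" "j \<le> j'" "\<not> b j' \<le> b j"
  have "(b j' - 1, j) \<in> Z"
    by (rule convex_cellsD[OF convex_Z Z_column_ends(1)[OF j(1)] Z_column_ends(2)[OF j(2)]])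
       (use j a_less_b[OF j(1)] in auto)
  then show False using j(4) in_Z_iff[of "b j' - 1" j] by linarith
qed

lemma split_filling_in: "(i, j) \<in> D \<Longrightarrow> split_filling s (i, j) =
    (if U (i, j) = k then (if i < s j then k else Suc k) else U (i, j))"
  by (simp add: split_filling_def)

text \<open>Two cells of \<open>Z\<close> compare correctly because \<open>s\<close> is antitone.
  For other pairs, the absence of \<open>Suc k\<close> in \<open>U\<close> leaves room for raising
  \<open>k\<close> to \<open>Suc k\<close>.\<close>

lemma split_filling_mem:
  assumes s: "s \<in> boxed_antitone J a b"
  shows "split_filling s \<in> merge_class"
proof -
  have ge1: "1 \<le> U c" if "c \<in> D" for c using U_rpp that by (auto simp: rpps_def fillings_def)
  have fill: "split_filling s \<in> fillings D"
    using ge1 by (fastforce simp: fillings_def split_filling_def PiE_iff split: if_splits)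
  have mono: "split_filling s (i, j) \<le> split_filling s (i', j')"
    if c: "(i, j) \<in> D" "(i', j') \<in> D" "i \<le> i'" "j \<le> j'" for i j i' j'
  proof -
    have le: "U (i, j) \<le> U (i', j')" using rpp_mono[OF U_rpp convex_D c] .
    show ?thesis
    proof (cases "U (i, j) = k \<and> U (i', j') = k")
      case True
      then have "(i, j) \<in> Z" "(i', j') \<in> Z" using c by (simp_all add: Z_def)
      then have "j \<in> J" "j' \<in> J" by (simp_all add: in_Z_iff)
      then have "s j' \<le> s j" using s c(4) by (simp add: boxed_antitone_def monotone_on_def)
      then show ?thesis using c True by (simp add: split_filling_in)
    qed (use le c U_merged[OF c(1)] U_merged[OF c(2)] in \<open>auto simp: split_filling_in\<close>)
  qed
  have "merge k (split_filling s c) = U c" if "c \<in> D" for c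
    using that U_merged[OF that] by (cases c) (auto simp: merge_def split_filling_in)
  then show ?thesis using fill mono by (auto simp: merge_class_def rpps_def)
qed

lemma separator_exists:
  assumes T: "T \<in> rpps D" and j: "j \<in> J" and val: "\<And>i. (i, j) \<in> Z \<Longrightarrow> T (i, j) \<in> {k, Suc k}"
  shows "\<exists>v. a j \<le> v \<and> v \<le> b j \<and> (\<forall>i. (i, j) \<in> Z \<longrightarrow> T (i, j) = (if i < v then k else Suc k))"
proof -
  \<comment> \<open>Admitting \<open>b j\<close> ensures that the least element exists, is at most
    \<open>b j\<close>, and equals \<open>b j\<close> if the column has no \<open>Suc k\<close> in
    \<open>Z\<close>.\<close>
  define v where "v = (LEAST v. v = b j \<or> a j \<le> v \<and> T (v, j) = Suc k)"
  have "v = b j \<or> a j \<le> v \<and> T (v, j) = Suc k"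
    unfolding v_def by (rule LeastI[of _ "b j"]) simp
  moreover have least: "v \<le> i" if "i = b j \<or> a j \<le> i \<and> T (i, j) = Suc k" for i
    unfolding v_def using that by (rule Least_le)
  ultimately have v: "a j \<le> v" "v \<le> b j" "v < b j \<Longrightarrow> T (v, j) = Suc k"
    using a_less_b[OF j] by (auto simp: less_imp_le)
  have "T (i, j) = (if i < v then k else Suc k)" if i: "(i, j) \<in> Z" for i
  proof (cases "i < v")
    case True
    then have "T (i, j) \<noteq> Suc k" using least[of i] i in_Z_iff[of i j] by force
    then show ?thesis using val[OF i] True by simp
  next
    case False
    then have vb: "v < b j" using i in_Z_iff[of i j] by simp
    then have "(v, j) \<in> Z" using v j in_Z_iff by blast
    then have "T (v, j) \<le> T (i, j)"
      using rpp_mono[OF T convex_D, of v j i j] i False by (simp add: Z_def)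
    then show ?thesis using v(3)[OF vb] val[OF i] False by auto
  qed
  with v show ?thesis by blast
qed

lemma split_filling_bij: "bij_betw split_filling (boxed_antitone J a b) merge_class"
  unfolding bij_betw_def
proof
  show "inj_on split_filling (boxed_antitone J a b)"
  proof (rule inj_onI)
    fix s s' assume s: "s \<in> boxed_antitone J a b" "s' \<in> boxed_antitone J a b"
      and eq: "split_filling s = split_filling s'"
    have iff: "i < s j \<longleftrightarrow> i < s' j" if "(i, j) \<in> Z" for i j
      using that fun_cong[OF eq, of "(i, j)"] by (auto simp: split_filling_in Z_def split: if_splits)
    have "s j = s' j" if j: "j \<in> J" for j
    proof (rule ccontr)
      assume "s j \<noteq> s' j"
      moreover have "s j \<in> {a j..b j}" "s' j \<in> {a j..b j}" using s j by (auto simp: boxed_antitone_def)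
      \<comment> \<open>In the row of the smaller separator, one filling has \<open>Suc k\<close>
        and the other \<open>k\<close>.\<close>
      ultimately have "(min (s j) (s' j), j) \<in> Z" using j by (auto simp: in_Z_iff)
      from iff[OF this] \<open>s j \<noteq> s' j\<close> show False by (auto simp: min_def split: if_splits)
    qed
    then show "s = s'" using s by (intro PiE_ext[of s J]) (auto simp: boxed_antitone_def)
  qed
  show "split_filling ` boxed_antitone J a b = merge_class"
  proof (intro equalityI image_subsetI subsetI)
    fix T assume T: "T \<in> merge_class"
    then have T_rpp: "T \<in> rpps D" by (simp add: merge_class_def)
    have val: "T c \<in> {k, Suc k}" if "c \<in> Z" for c
      using T that by (fastforce simp: merge_class_def merge_def Z_def split: if_splits)
    have "\<forall>j\<in>J. \<exists>v. a j \<le> v \<and> v \<le> b j \<and> (\<forall>i. (i, j) \<in> Z \<longrightarrow> T (i, j) = (if i < v then k else Suc k))"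
      using separator_exists[OF T_rpp _ val] by blast
    then obtain s where s: "\<And>j. j \<in> J \<Longrightarrow> a j \<le> s j \<and> s j \<le> b j"
      "\<And>i j. (i, j) \<in> Z \<Longrightarrow> T (i, j) = (if i < s j then k else Suc k)"
      unfolding bchoice_iff using in_Z_iff by metis
    have "antimono_on J s"
    proof (intro monotone_onI, rule ccontr)
      fix j j' assume j: "j \<in> J" "j' \<in> J" "j \<le> j'" "\<not> s j' \<le> s j"
      \<comment> \<open>Antitone bounds put row \<open>s j\<close> into \<open>Z\<close> in both
        columns; there \<open>T\<close> has \<open>Suc k\<close> at \<open>j\<close> but
        \<open>k\<close> further right at \<open>j'\<close>.\<close>
      have "a j' \<le> a j" "b j' \<le> b j" using j antimono_a antimono_b by (auto simp: monotone_on_def)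
      then have Z: "(s j, j) \<in> Z" "(s j, j') \<in> Z"
        using s(1)[OF j(1)] s(1)[OF j(2)] j by (auto simp: in_Z_iff)
      then have "T (s j, j) \<le> T (s j, j')"
        using rpp_mono[OF T_rpp convex_D] j(3) by (simp add: Z_def)
      then show False using s(2)[OF Z(1)] s(2)[OF Z(2)] j(4) by simp
    qed
    then have mem: "restrict s J \<in> boxed_antitone J a b"
      using s(1) by (auto simp: boxed_antitone_def monotone_on_def)
    have "T c = split_filling (restrict s J) c" for c
    proof (cases "c \<in> D")
      case True
      obtain i j where c: "c = (i, j)" by (cases c)
      show ?thesis
      proof (cases "(i, j) \<in> Z")
        case True
        then have "j \<in> J" "(i, j) \<in> D" "U (i, j) = k" by (auto simp: J_def Z_def intro: rev_image_eqI)
        then show ?thesis using s(2)[OF True] c by (simp add: split_filling_in)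
      next
        case False
        then have "U (i, j) \<noteq> k" "merge k (T (i, j)) = U (i, j)"
          using T \<open>c \<in> D\<close> c by (auto simp: Z_def merge_class_def)
        then show ?thesis using \<open>c \<in> D\<close> c by (auto simp: split_filling_in merge_def split: if_splits)
      qed
    next
      case False
      then show ?thesis using T
        by (cases c) (auto simp: merge_class_def rpps_def fillings_def PiE_iff extensional_def split_filling_def)
    qed
    then show "T \<in> split_filling ` boxed_antitone J a b" using mem by blast
  qed (rule split_filling_mem)
qed

text \<open>The separator cuts the rows of \<open>Z\<close> in column \<open>j\<close> into two
  intervals, one filled with \<open>k\<close> and one with \<open>Suc k\<close>; at an endpoint one
  of them is empty.\<close>

lemma column_values_split:
  assumes s: "s \<in> boxed_antitone J a b"
  shows "column_values D (split_filling s) j = (column_values D U j - {k}) \<union>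
    (if j \<in> J then (if s j = b j then {k} else if s j = a j then {Suc k} else {k, Suc k}) else {})"
proof -
  have "column_values D (split_filling s) j = (column_values D U j - {k}) \<union>
      (\<lambda>i. if i < s j then k else Suc k) ` {i. (i, j) \<in> Z}"
  proof (rule set_eqI)
    fix r
    let ?P = "\<lambda>i. (i, j) \<in> D \<and> split_filling s (i, j) = r"
    have "r \<in> column_values D (split_filling s) j \<longleftrightarrow>
        (\<exists>i. U (i, j) \<noteq> k \<and> ?P i) \<or> (\<exists>i. U (i, j) = k \<and> ?P i)"
      by (auto simp: column_values_def)
    also have "(\<exists>i. U (i, j) \<noteq> k \<and> ?P i) \<longleftrightarrow> r \<in> column_values D U j - {k}"
      by (auto simp: column_values_def split_filling_in)
    also have "(\<exists>i. U (i, j) = k \<and> ?P i) \<longleftrightarrow>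
        r \<in> (\<lambda>i. if i < s j then k else Suc k) ` {i. (i, j) \<in> Z}"
    proof -
      have "U (i, j) = k \<and> ?P i \<longleftrightarrow> (i, j) \<in> Z \<and> (if i < s j then k else Suc k) = r" for i
        by (cases "(i, j) \<in> D"; cases "U (i, j) = k") (simp_all add: Z_def split_filling_in)
      then show ?thesis by (simp only: image_iff mem_Collect_eq Bex_def eq_commute[of r])
    qed
    finally show "r \<in> column_values D (split_filling s) j \<longleftrightarrow> r \<in> (column_values D U j - {k}) \<union>
        (\<lambda>i. if i < s j then k else Suc k) ` {i. (i, j) \<in> Z}" by simp
  qed
  also have "(\<lambda>i. if i < s j then k else Suc k) ` {i. (i, j) \<in> Z} =
      (if j \<in> J then (if s j = b j then {k} else if s j = a j then {Suc k} else {k, Suc k}) else {})"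
  proof (cases "j \<in> J")
    case True
    then have sj: "a j \<le> s j" "s j \<le> b j" using s by (auto simp: boxed_antitone_def)
    have rows: "{i. (i, j) \<in> Z} = {a j..<s j} \<union> {s j..<b j}" using sj True by (auto simp: in_Z_iff)
    have images: "(\<lambda>i. if i < s j then k else Suc k) ` {a j..<s j} = (if a j < s j then {k} else {})"
      "(\<lambda>i. if i < s j then k else Suc k) ` {s j..<b j} = (if s j < b j then {Suc k} else {})"
      by (simp_all add: image_constant_conv cong: image_cong_simp)
    show ?thesis unfolding rows image_Un images using sj True a_less_b[OF True] by auto
  qed (auto simp: in_Z_iff)
  finally show ?thesis .
qed

text \<open>Since \<open>U\<close> avoids \<open>Suc k\<close>, all its breaks survive, and a new
  one arises only between rows \<open>s j - 1\<close> and \<open>s j\<close> when both lie in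
  \<open>Z\<close>.\<close>

lemma column_breaks_split:
  assumes s: "s \<in> boxed_antitone J a b"
  shows "column_breaks D (split_filling s) j = column_breaks D U j \<union>
    (if j \<in> J \<and> s j \<noteq> a j \<and> s j \<noteq> b j then {s j - 1} else {})"
proof -
  have "i \<in> column_breaks D (split_filling s) j \<longleftrightarrow>
      i \<in> column_breaks D U j \<or> (i, j) \<in> Z \<and> (Suc i, j) \<in> Z \<and> Suc i = s j" for i
    using U_merged[of "(i, j)"] U_merged[of "(Suc i, j)"]
    by (cases "(i, j) \<in> D"; cases "(Suc i, j) \<in> D"; cases "U (i, j) = k"; cases "U (Suc i, j) = k")
       (simp_all add: column_breaks_def split_filling_in Z_def, linarith?)
  moreover have "(i, j) \<in> Z \<and> (Suc i, j) \<in> Z \<and> Suc i = s j \<longleftrightarrow>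
      j \<in> J \<and> s j \<noteq> a j \<and> s j \<noteq> b j \<and> i = s j - 1" for i
    using s by (auto simp: in_Z_iff boxed_antitone_def PiE_iff)
  ultimately show ?thesis by auto
qed

text \<open>The factor common to the whole class: it involves neither the separators nor
  \<open>x k\<close> and \<open>x (Suc k)\<close>.\<close>

definition outer_weight :: "(nat \<Rightarrow> 'r) \<Rightarrow> (nat \<Rightarrow> 'r) \<Rightarrow> 'r::comm_ring_1" where
  "outer_weight x u =
     (\<Prod>j\<in>snd ` D. (\<Prod>r\<in>column_values D U j - {k}. x r) * (\<Prod>i\<in>column_breaks D U j. u i))"

text \<open>The shift to \<open>u (v - 1)\<close> reflects that the break at separator
  \<open>v\<close> is recorded in its upper row.\<close>

lemma rpp_weight_split:
  assumes s: "s \<in> boxed_antitone J a b"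
  shows "rpp_weight x u D (split_filling s) =
    outer_weight x u * (\<Prod>j\<in>J. sep_weight (x k) (x (Suc k)) (\<lambda>v. u (v - 1)) (a j) (b j) (s j))"
proof -
  let ?w = "\<lambda>j. sep_weight (x k) (x (Suc k)) (\<lambda>v. u (v - 1)) (a j) (b j) (s j)"
  have "(\<Prod>r\<in>column_values D (split_filling s) j. x r) * (\<Prod>i\<in>column_breaks D (split_filling s) j. u i) =
      ((\<Prod>r\<in>column_values D U j - {k}. x r) * (\<Prod>i\<in>column_breaks D U j. u i)) *
      (if j \<in> J then ?w j else 1)" for j
  proof -
    have fin: "finite (column_values D U j)" "finite (column_breaks D U j)"
      using finite_D by (simp_all add: finite_column_values finite_column_breaks)
    have nin: "Suc k \<notin> column_values D U j" using U_merged by (auto simp: column_values_def)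
    have nin': "s j - 1 \<notin> column_breaks D U j" if "j \<in> J" "s j \<noteq> a j" "s j \<noteq> b j"
    proof -
      have "(s j - 1, j) \<in> Z" "(Suc (s j - 1), j) \<in> Z"
        using that s by (auto simp: in_Z_iff boxed_antitone_def PiE_iff)
      then show ?thesis by (simp add: column_breaks_def Z_def)
    qed
    define V where "V = column_values D U j - {k}"
    have V: "finite V" "k \<notin> V" "Suc k \<notin> V" using fin nin by (simp_all add: V_def)
    show ?thesis
      unfolding column_values_split[OF s] column_breaks_split[OF s] V_def[symmetric]
      using fin V nin' a_less_b[of j] by (auto simp: sep_weight_def insert_commute algebra_simps)
  qed
  then have "rpp_weight x u D (split_filling s) =
      outer_weight x u * (\<Prod>j\<in>snd ` D. if j \<in> J then ?w j else 1)"
    by (simp add: rpp_weight_def outer_weight_def prod.distrib)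
  also have "(\<Prod>j\<in>snd ` D. if j \<in> J then ?w j else 1) = (\<Prod>j\<in>snd ` D \<inter> J. ?w j)"
    by (rule prod.inter_restrict[symmetric]) (simp add: finite_D)
  also have "snd ` D \<inter> J = J" by (auto simp: J_def Z_def)
  finally show ?thesis .
qed

lemma merge_class_weight_symmetric:
  "(\<Sum>T\<in>merge_class. rpp_weight x u D T) =
   (\<Sum>T\<in>merge_class. rpp_weight (x \<circ> transpose k (Suc k)) u D T)"
proof -
  have reindex: "(\<Sum>T\<in>merge_class. rpp_weight y u D T) = outer_weight y u *
      (\<Sum>s\<in>boxed_antitone J a b.
        \<Prod>j\<in>J. sep_weight (y k) (y (Suc k)) (\<lambda>v. u (v - 1)) (a j) (b j) (s j))" for y :: "nat \<Rightarrow> 'a"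
    unfolding sum.reindex_bij_betw[OF split_filling_bij, symmetric]
    by (simp add: rpp_weight_split sum_distrib_left)
  have "outer_weight (x \<circ> transpose k (Suc k)) u = outer_weight x u"
    unfolding outer_weight_def
  proof (intro prod.cong refl arg_cong2[of _ _ _ _ "(*)"])
    fix j r assume "r \<in> column_values D U j - {k}"
    then have "r \<noteq> k" "r \<noteq> Suc k" using U_merged by (auto simp: column_values_def)
    then show "(x \<circ> transpose k (Suc k)) r = x r" by (simp add: transpose_def)
  qed
  then show ?thesis
    unfolding reindex
    using sum_sep_weight_symmetric[OF finite_J a_less_b antimono_a antimono_b,
        of "x k" "x (Suc k)" "\<lambda>v. u (v - 1)"] by simp
qed

end

subsection \<open>Exchanging adjacent indeterminates\<close>

lemma merge_mono: "r \<le> r' \<Longrightarrow> merge k r \<le> merge k r'"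
  by (auto simp: merge_def)

lemma finite_bounded_rpps:
  assumes "finite D"
  shows "finite {T \<in> rpps D. T ` D \<subseteq> {..n::nat}}"
proof (rule finite_subset)
  show "{T \<in> rpps D. T ` D \<subseteq> {..n}} \<subseteq> (D \<rightarrow>\<^sub>E {..n})"
    by (auto simp: rpps_def fillings_def PiE_def)
qed (simp add: assms finite_PiE)

text \<open>The cap \<open>n\<close> makes the sum finite. As \<open>Suc k \<le> n\<close>, it keeps
  or discards merge classes as a whole, and each class is symmetric by itself.\<close>

lemma rpp_weight_sum_symmetric:
  assumes D: "finite D" "convex_cells D" and k: "1 \<le> k" "Suc k \<le> n"
  shows "(\<Sum>T\<in>{T \<in> rpps D. T ` D \<subseteq> {..n}}. rpp_weight x u D T) =
    (\<Sum>T\<in>{T \<in> rpps D. T ` D \<subseteq> {..n}}. rpp_weight (x \<circ> transpose k (Suc k)) u D T)"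
proof -
  let ?A = "{T \<in> rpps D. T ` D \<subseteq> {..n}}"
  define \<pi> where "\<pi> T = restrict (merge k \<circ> T) D" for T :: "nat \<times> nat \<Rightarrow> nat"
  have finA: "finite ?A" by (rule finite_bounded_rpps[OF D(1)])
  have "(\<Sum>T\<in>{T. T \<in> ?A \<and> \<pi> T = U}. rpp_weight x u D T) =
      (\<Sum>T\<in>{T. T \<in> ?A \<and> \<pi> T = U}. rpp_weight (x \<circ> transpose k (Suc k)) u D T)"
    if U: "U \<in> \<pi> ` ?A" for U
  proof -
    obtain T0 where T0: "T0 \<in> ?A" "U = \<pi> T0" using U by blast
    have U_in: "U c = merge k (T0 c)" if "c \<in> D" for c using T0 that by (simp add: \<pi>_def)
    interpret merged_rpp D k U
    proof
      show "U \<in> rpps D"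
        using T0 k merge_mono
        by (fastforce simp: rpps_def fillings_def PiE_iff U_in \<pi>_def merge_def)
    qed (use D U_in in \<open>auto simp: merge_def\<close>)
    have "\<pi> T = U \<longleftrightarrow> (\<forall>c\<in>D. merge k (T c) = U c)" for T
      by (auto simp: T0 \<pi>_def restrict_def fun_eq_iff)
    moreover have "T ` D \<subseteq> {..n}" if T: "\<forall>c\<in>D. merge k (T c) = U c" for T
    proof (intro image_subsetI)
      fix c assume c: "c \<in> D"
      then have "merge k (T c) = merge k (T0 c)" "T0 c \<le> n" using T U_in T0 by auto
      then show "T c \<in> {..n}" using k by (auto simp: merge_def split: if_splits)
    qed
    ultimately have "{T. T \<in> ?A \<and> \<pi> T = U} = merge_class" unfolding merge_class_def by blast
    then show ?thesis by (simp add: merge_class_weight_symmetric[of x u])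
  qed
  then show ?thesis unfolding sum.image_gen[OF finA, of _ \<pi>] by (rule sum.cong[OF refl])
qed

text \<open>
  \<open>breaks\<close> is complementary to \<open>ceq\<close>. Unlike the equalities, the breaks caused by separating
  \<open>k\<close> from \<open>k + 1\<close> in a column depend only on the position of the separator.
\<close>

definition breaks :: "(nat \<times> nat) set \<Rightarrow> (nat \<times> nat \<Rightarrow> nat) \<Rightarrow> exponent" where
  "breaks D T = (\<Sum>j\<in>snd ` D. \<Sum>i\<in>column_breaks D T j. Poly_Mapping.single i 1)"

section \<open>Comparison of coefficients\<close>

lemma prod_single_one:
  "(\<Prod>i\<in>A. Poly_Mapping.single (f i) 1) =
   (Poly_Mapping.single (\<Sum>i\<in>A. f i) 1 :: 'a::comm_monoid_add \<Rightarrow>\<^sub>0 'b::comm_semiring_1)"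
  by (induction A rule: infinite_finite_induct) (simp_all add: mult_single)

lemma lookup_sum_sum_single:
  fixes f :: "'i \<Rightarrow> 'k"
  assumes "finite J" "\<And>j. j \<in> J \<Longrightarrow> finite (S j)" "inj f"
  shows "Poly_Mapping.lookup (\<Sum>j\<in>J. \<Sum>i\<in>S j. Poly_Mapping.single (f i) (1::nat)) (f r) =
    card {j \<in> J. r \<in> S j}"
proof -
  have "Poly_Mapping.lookup (\<Sum>j\<in>J. \<Sum>i\<in>S j. Poly_Mapping.single (f i) (1::nat)) (f r) =
      (\<Sum>j\<in>J. \<Sum>i\<in>S j. if i = r then 1 else 0)"
    using assms(3) by (simp del: One_nat_def add: lookup_sum lookup_single when_def inj_eq)
  also have "\<dots> = (\<Sum>j\<in>J. if r \<in> S j then 1 else 0)"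
    by (rule sum.cong) (use assms in auto)
  also have "\<dots> = card {j \<in> J. r \<in> S j}"
    using assms(1) by (simp add: sum.inter_filter[symmetric])
  finally show ?thesis .
qed

lemma lookup_breaks:
  assumes "finite D"
  shows "Poly_Mapping.lookup (breaks D T) i =
    card {j. (i, j) \<in> D \<and> (Suc i, j) \<in> D \<and> T (i, j) \<noteq> T (Suc i, j)}"
proof -
  have "{j \<in> snd ` D. i \<in> column_breaks D T j} =
      {j. (i, j) \<in> D \<and> (Suc i, j) \<in> D \<and> T (i, j) \<noteq> T (Suc i, j)}"
    by (force simp: column_breaks_def)
  then show ?thesis
    using lookup_sum_sum_single[of "snd ` D" "column_breaks D T" "\<lambda>i. i" i] assms
    by (simp add: breaks_def finite_column_breaks)
qed

text \<open>Specialises the weights to integer polynomials in two families of indeterminates, with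
  pairs of exponents as monomials. Renaming by \<open>f\<close> yields \<open>map_key f\<close>
  because \<open>f\<close> is its own inverse.\<close>

lemma rpp_weight_monomial:
  assumes D: "finite D" and f: "\<And>r. f (f r) = r"
  shows "rpp_weight (\<lambda>r. Poly_Mapping.single (Poly_Mapping.single (f r) 1, 0) 1)
      (\<lambda>i. Poly_Mapping.single (0, Poly_Mapping.single i 1) 1) D T =
    (Poly_Mapping.single (Poly_Mapping.map_key f (ircont D T), breaks D T) 1 ::
      (exponent \<times> exponent) \<Rightarrow>\<^sub>0 int)"
proof -
  have inj: "inj f" by (metis f injI)
  have "(\<Sum>j\<in>snd ` D. \<Sum>r\<in>column_values D T j. Poly_Mapping.single (f r) 1) =
      Poly_Mapping.map_key f (ircont D T)"
  proof (rule poly_mapping_eqI)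
    fix r
    have "{j \<in> snd ` D. f r \<in> column_values D T j} = {j. \<exists>i. (i, j) \<in> D \<and> T (i, j) = f r}"
      by (force simp: column_values_def)
    then show "Poly_Mapping.lookup (\<Sum>j\<in>snd ` D. \<Sum>r\<in>column_values D T j. Poly_Mapping.single (f r) 1) r =
        Poly_Mapping.lookup (Poly_Mapping.map_key f (ircont D T)) r"
      using lookup_sum_sum_single[of "snd ` D" "column_values D T" f "f r"] D inj
      by (simp add: f finite_column_values lookup_ircont map_key.rep_eq)
  qed
  then have "(\<Sum>j\<in>snd ` D. (\<Sum>r\<in>column_values D T j. (Poly_Mapping.single (f r) 1, 0)) +
      (\<Sum>i\<in>column_breaks D T j. (0, Poly_Mapping.single i 1))) =
      (Poly_Mapping.map_key f (ircont D T), breaks D T)"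
    by (simp add: prod_eq_iff fst_sum snd_sum breaks_def)
  then show ?thesis
    by (simp add: rpp_weight_def prod_single_one mult_single)
qed

lemma keys_ircont:
  assumes "finite D" "c \<in> D"
  shows "T c \<in> Poly_Mapping.keys (ircont D T)"
proof -
  obtain i j where c: "c = (i, j)" by (cases c)
  have "{j'. \<exists>i'. (i', j') \<in> D \<and> T (i', j') = T c} \<subseteq> snd ` D" by force
  then have "finite {j'. \<exists>i'. (i', j') \<in> D \<and> T (i', j') = T c}"
    by (rule finite_subset) (use assms in simp)
  then have "card {j'. \<exists>i'. (i', j') \<in> D \<and> T (i', j') = T c} \<noteq> 0"
    using assms(2) c by (auto simp: card_eq_0_iff)
  then show ?thesis by (simp add: in_keys_iff lookup_ircont[OF assms(1)])
qed

lemma lookup_sum_single_one: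
  assumes "finite A"
  shows "Poly_Mapping.lookup (\<Sum>x\<in>A. Poly_Mapping.single (f x) (1::int)) z = int (card {x \<in> A. f x = z})"
  using assms by (auto simp: lookup_sum lookup_single when_def sum.inter_filter[symmetric]
      intro: arg_cong[of _ _ card])

text \<open>Both counts are coefficients at \<open>(\<alpha>, \<delta>)\<close> of the two sides of
  \<open>rpp_weight_sum_symmetric\<close>.\<close>

lemma card_rpps_transpose:
  assumes D: "finite D" "convex_cells D" and k: "1 \<le> k"
  defines "\<tau> \<equiv> transpose k (Suc k)"
  shows "card {T \<in> rpps D. ircont D T = Poly_Mapping.map_key \<tau> \<alpha> \<and> breaks D T = \<delta>} =
    card {T \<in> rpps D. ircont D T = \<alpha> \<and> breaks D T = \<delta>}"
proof -
  let ?k = "Poly_Mapping.map_key \<tau>"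
  have inv: "\<tau> (\<tau> r) = r" for r by (simp add: \<tau>_def)
  have inj: "inj \<tau>" by (metis inv injI)
  have invol: "?k (?k \<gamma>) = \<gamma>" for \<gamma> :: exponent
    by (rule poly_mapping_eqI) (simp add: map_key.rep_eq inj inv)
  \<comment> \<open>Large enough that the cap loses none of the counted fillings, whose entries lie
    in the support of \<open>\<alpha>\<close> or of its image.\<close>
  define n where "n = Max (insert (Suc k) (Poly_Mapping.keys \<alpha> \<union> Poly_Mapping.keys (?k \<alpha>)))"
  have n: "Suc k \<le> n" unfolding n_def by (rule Max_ge) auto
  have keys_n: "r \<le> n" if "r \<in> Poly_Mapping.keys \<alpha> \<union> Poly_Mapping.keys (?k \<alpha>)" for r
    unfolding n_def by (rule Max_ge) (use that in auto)
  let ?A = "{T \<in> rpps D. T ` D \<subseteq> {..n}}"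
  have finA: "finite ?A" by (rule finite_bounded_rpps[OF D(1)])
  let ?u = "\<lambda>i. Poly_Mapping.single (0, Poly_Mapping.single i 1) 1 :: (exponent \<times> exponent) \<Rightarrow>\<^sub>0 int"
  let ?x = "\<lambda>r. Poly_Mapping.single (Poly_Mapping.single r 1, 0) 1 :: (exponent \<times> exponent) \<Rightarrow>\<^sub>0 int"
  have "(\<Sum>T\<in>?A. rpp_weight ?x ?u D T) = (\<Sum>T\<in>?A. rpp_weight (\<lambda>r. ?x (\<tau> r)) ?u D T)"
    using rpp_weight_sum_symmetric[OF D k n, of ?x ?u] by (simp add: comp_def \<tau>_def)
  moreover have "rpp_weight ?x ?u D T = Poly_Mapping.single (ircont D T, breaks D T) 1" for T
    using rpp_weight_monomial[OF D(1), of "\<lambda>r. r" T] by (simp add: map_key_id)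
  moreover have "rpp_weight (\<lambda>r. ?x (\<tau> r)) ?u D T = Poly_Mapping.single (?k (ircont D T), breaks D T) 1" for T
    using rpp_weight_monomial[OF D(1), of \<tau> T] inv by simp
  ultimately have "(\<Sum>T\<in>?A. Poly_Mapping.single (ircont D T, breaks D T) (1::int)) =
      (\<Sum>T\<in>?A. Poly_Mapping.single (?k (ircont D T), breaks D T) 1)" by simp
  then have "int (card {T \<in> ?A. (ircont D T, breaks D T) = (\<alpha>, \<delta>)}) =
      int (card {T \<in> ?A. (?k (ircont D T), breaks D T) = (\<alpha>, \<delta>)})"
    unfolding lookup_sum_single_one[OF finA, symmetric] by simp
  moreover have "{T \<in> ?A. (ircont D T, breaks D T) = (\<alpha>, \<delta>)} =
      {T \<in> rpps D. ircont D T = \<alpha> \<and> breaks D T = \<delta>}"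
    using keys_ircont[OF D(1)] keys_n by auto
  moreover have "{T \<in> ?A. (?k (ircont D T), breaks D T) = (\<alpha>, \<delta>)} =
      {T \<in> rpps D. ircont D T = ?k \<alpha> \<and> breaks D T = \<delta>}"
  proof -
    have "?k (ircont D T) = \<alpha> \<longleftrightarrow> ircont D T = ?k \<alpha>" for T using invol by metis
    moreover have "T ` D \<subseteq> {..n}" if "ircont D T = ?k \<alpha>" for T
      using keys_ircont[OF D(1), of _ T] keys_n that by auto
    ultimately show ?thesis by auto
  qed
  ultimately show ?thesis by simp
qed

text \<open>Vertically adjacent pairs split into equalities and breaks, and their number per row
  depends on \<open>D\<close> alone. The truncated subtraction is exact, as breaks are among these
  pairs.\<close>

lemma ceq_conv_breaks:
  assumes "finite D"
  shows "ceq D T = Abs_poly_mapping (\<lambda>i. card {j. (i, j) \<in> D \<and> (Suc i, j) \<in> D}) - breaks D T"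
proof (rule poly_mapping_eqI)
  fix i
  let ?P = "\<lambda>i. {j. (i, j) \<in> D \<and> (Suc i, j) \<in> D}"
  have fin: "finite (?P i)" for i
    by (rule finite_subset[of _ "snd ` D"]) (use assms in force)+
  have "{i. card (?P i) \<noteq> 0} \<subseteq> fst ` D"
  proof (rule subsetI)
    fix i assume "i \<in> {i. card (?P i) \<noteq> 0}"
    then have "?P i \<noteq> {}" by (metis (mono_tags) card.empty mem_Collect_eq)
    then show "i \<in> fst ` D" by force
  qed
  then have "finite {i. card (?P i) \<noteq> 0}" by (rule finite_subset) (use assms in simp)
  then have look: "Poly_Mapping.lookup (Abs_poly_mapping (\<lambda>i. card (?P i))) i = card (?P i)" by simp
  have "card (?P i) = card ({j \<in> ?P i. T (i, j) = T (Suc i, j)} \<union> {j \<in> ?P i. T (i, j) \<noteq> T (Suc i, j)})"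
    by (rule arg_cong[of _ _ card]) auto
  also have "\<dots> = card {j \<in> ?P i. T (i, j) = T (Suc i, j)} + card {j \<in> ?P i. T (i, j) \<noteq> T (Suc i, j)}"
    by (rule card_Un_disjoint) (auto intro: finite_subset[OF _ fin[of i]])
  finally show "Poly_Mapping.lookup (ceq D T) i =
      Poly_Mapping.lookup (Abs_poly_mapping (\<lambda>i. card (?P i)) - breaks D T) i"
    by (simp add: lookup_ceq[OF assms] lookup_breaks[OF assms] lookup_minus look conj_assoc)
qed

lemma sum_eq_if_card_fibres_eq:
  fixes F :: "'c \<Rightarrow> 'd::comm_semiring_1"
  assumes "finite A" "finite B" "\<And>y. card {a \<in> A. f a = y} = card {b \<in> B. g b = y}"
  shows "(\<Sum>a\<in>A. F (f a)) = (\<Sum>b\<in>B. F (g b))"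
proof -
  let ?Y = "f ` A \<union> g ` B"
  have "(\<Sum>a\<in>A. F (f a)) = (\<Sum>y\<in>?Y. \<Sum>a\<in>{a \<in> A. f a = y}. F (f a))"
    by (rule sum.group[symmetric]) (use assms in auto)
  also have "\<dots> = (\<Sum>y\<in>?Y. \<Sum>b\<in>{b \<in> B. g b = y}. F (g b))"
    by (rule sum.cong) (simp_all add: assms(3))
  also have "\<dots> = (\<Sum>b\<in>B. F (g b))"
    by (rule sum.group) (use assms in auto)
  finally show ?thesis .
qed

text \<open>By \<open>ceq_conv_breaks\<close> a summand depends on \<open>T\<close> only through
  \<open>breaks D T\<close>, so it suffices to count fillings with given
  \<open>breaks\<close>.\<close>

lemma g_tilde_adjacent:
  assumes "skew_partition lam mu" "1 \<le> k"
  shows "g_tilde lam mu (Poly_Mapping.map_key (transpose k (Suc k)) \<alpha>) = g_tilde lam mu \<alpha>"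
proof -
  define D where "D = skew_diagram lam mu"
  have D: "finite D" "convex_cells D"
    using assms by (simp_all add: D_def finite_skew_diagram convex_skew_diagram skew_partition_def)
  show ?thesis
    unfolding g_tilde_coeff[OF D_def] ceq_conv_breaks[OF D(1)]
    by (rule sum_eq_if_card_fibres_eq)
       (use finite_rpps_ircont[OF D(1)] card_rpps_transpose[OF D assms(2)] in \<open>simp_all add: conj_assoc\<close>)
qed

subsection \<open>From adjacent transpositions to all finitary permutations\<close>

lemma invariant_comp:
  assumes "inj p" "inj q"
    and "\<And>\<alpha>. f (Poly_Mapping.map_key p \<alpha>) = f \<alpha>" "\<And>\<alpha>. f (Poly_Mapping.map_key q \<alpha>) = f \<alpha>"
  shows "f (Poly_Mapping.map_key (p \<circ> q) \<alpha>) = f \<alpha>"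
  using assms(3,4) map_key_compose[OF assms(2,1)] by metis

lemma symmetric_in_x_if_adjacent:
  assumes adj: "\<And>k \<alpha>. 1 \<le> k \<Longrightarrow> f (Poly_Mapping.map_key (transpose k (Suc k)) \<alpha>) = f \<alpha>"
  shows "symmetric_in_x f"
proof -
  have less: "f (Poly_Mapping.map_key (transpose a b) \<alpha>) = f \<alpha>" if "1 \<le> a" "a < b" for a b \<alpha>
    using Suc_leI[OF that(2)]
  proof (induction b arbitrary: \<alpha> rule: dec_induct)
    case base
    show ?case using adj[OF that(1)] .
  next
    case (step b)
    \<comment> \<open>Conjugation by an adjacent transposition lengthens the distance by
      one.\<close>
    have "transpose a (Suc b) = transpose b (Suc b) \<circ> (transpose a b \<circ> transpose b (Suc b))"
      using step by (auto simp: fun_eq_iff transpose_def)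
    moreover have "1 \<le> b" using step that by simp
    ultimately show ?case
      by (simp only:) (intro invariant_comp adj step.IH inj_compose inj_on_transpose; simp)
  qed
  have trans: "f (Poly_Mapping.map_key (transpose a b) \<alpha>) = f \<alpha>" if "1 \<le> a" "1 \<le> b" for a b \<alpha>
  proof (cases a b rule: linorder_cases)
    case equal
    then show ?thesis by (simp add: id_def map_key_id)
  qed (use less[of a b] less[of b a] that in \<open>simp_all add: transpose_commute\<close>)
  have "f (Poly_Mapping.map_key p \<alpha>) = f \<alpha>" if p: "p permutes {1..}" "finite {i. p i \<noteq> i}" for p \<alpha>
  proof -
    have sub: "{i. p i \<noteq> i} \<subseteq> {1..}" using p(1) by (auto simp: permutes_def)
    have "p permutes {i. p i \<noteq> i}" by (rule permutes_superset[OF p(1)]) auto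
    \<comment> \<open>Injectivity is carried along because \<open>invariant_comp\<close> requires
      it; \<open>sub\<close> keeps the transpositions away from index 0.\<close>
    from p(2) this have "inj p \<and> (\<forall>\<alpha>. f (Poly_Mapping.map_key p \<alpha>) = f \<alpha>)"
    proof (induction rule: permutes_rev_induct)
      case id
      then show ?case by (simp add: id_def map_key_id)
    next
      case (swap a b q)
      then have "1 \<le> a" "1 \<le> b" using sub by auto
      then show ?case
        using swap by (intro conjI allI invariant_comp trans inj_compose inj_on_transpose) auto
    qed
    then show ?thesis by blast
  qed
  then show ?thesis by (auto simp: symmetric_in_x_def permute_x_def fun_eq_iff)
qed

theorem theorem3p3:
  fixes lam mu :: exponent
  assumes "skew_partition lam mu"
  shows "symmetric_in_x (g_tilde lam mu)"
  using assms by (intro symmetric_in_x_if_adjacent g_tilde_adjacent)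

end
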